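(* Let $\Omega\subset\mathbb{R}^2$ be a domain and let $X=X(t,\theta)\colon\Omega\to\mathbb{R}^3$ be an orthogonal parametrization (i.e. $X_t\cdot X_\theta=0$) of a smooth regular surface with unit normal $N=\frac{X_t\wedge X_\theta}{|X_t||X_\theta|}$. For any given $\varphi\in C^2(\Omega)$ and any fixed $(t,\theta)\in\Omega$ one has $$\begin{aligned} &\frac{d^2}{ds^2}\left[\mathfrak{M}(X+s\varphi N)\right]_{s=0}=\varphi_t^2\left(\frac12\frac{X_{tt}\cdot N}{|X_t|^4}-\frac12\frac{X_{\theta\theta}\cdot N}{|X_t|^2|X_\theta|^2}\right)+\varphi_\theta^2\left(-\frac12\frac{X_{tt}\cdot N}{|X_t|^2|X_\theta|^2}+\frac12\frac{X_{\theta\theta}\cdot N}{|X_\theta|^4}\right)\\ &+\varphi^2\Bigg(-6\frac{(N_t\cdot N_\theta)(X_{t\theta}\cdot N)}{|X_t|^2|X_\theta|^2}+12\frac{(X_{tt}\cdot N)(X_{t\theta}\cdot N)^2}{|X_t|^4|X_\theta|^2}+12\frac{(X_{\theta\theta}\cdot N)(X_{t\theta}\cdot N)^2}{|X_t|^2|X_\theta|^4}\\ &\qquad-3\frac{(X_{tt}\cdot N)|N_t|^2}{|X_t|^4}-3\frac{(X_{\theta\theta}\cdot N)|N_\theta|^2}{|X_\theta|^4}+4\frac{(X_{tt}\cdot N)^3}{|X_t|^6}+4\frac{(X_{\theta\theta}\cdot N)^3}{|X_\theta|^6}\Bigg)+\varphi_t\varphi_\theta\left(2\frac{X_{t\theta}\cdot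 N}{|X_t|^2|X_\theta|^2}\right)\\ &+\varphi\varphi_t\Bigg(-\frac{N_{\theta\theta}\cdot X_t}{|X_t|^2|X_\theta|^2}-\frac{N_{tt}\cdot X_t}{|X_t|^4}-\frac32\frac{X_{tt}\cdot N}{|X_t|^6}\frac{d|X_t|^2}{dt}+\frac{X_{\theta\theta}\cdot N}{|X_t|^2|X_\theta|^4}\frac{d|X_\theta|^2}{dt}+\frac12\frac{X_{tt}\cdot N}{|X_t|^4|X_\theta|^2}\frac{d|X_\theta|^2}{dt}\\ &\qquad-\frac12\frac{X_{t\theta}\cdot N}{|X_t|^2|X_\theta|^4}\frac{d|X_\theta|^2}{d\theta}-\frac32\frac{X_{t\theta}\cdot N}{|X_t|^4|X_\theta|^2}\frac{d|X_t|^2}{d\theta}\Bigg)\\ &+\varphi\varphi_\theta\Bigg(-\frac{N_{tt}\cdot X_\theta}{|X_t|^2|X_\theta|^2}-\frac{N_{\theta\theta}\cdot X_\theta}{|X_\theta|^4}-\frac32\frac{X_{\theta\theta}\cdot N}{|X_\theta|^6}\frac{d|X_\theta|^2}{d\theta}+\frac{X_{tt}\cdot N}{|X_t|^4|X_\theta|^2}\frac{d|X_t|^2}{d\theta}+\frac12\frac{X_{\theta\theta}\cdot N}{|X_t|^2|X_\theta|^4}\frac{d|X_t|^2}{d\theta}\\ &\qquad-\frac12\frac{X_{t\theta}\cdot N}{|X_t|^4|X_\theta|^2}\frac{d|X_t|^2}{dt}-\frac32\frac{X_{t\theta}\cdot N}{|X_t|^2|X_\theta|^4}\frac{d|X_\theta|^2}{dt}\Bigg)\\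 &+\varphi\varphi_{\theta\theta}\left(2\frac{X_{\theta\theta}\cdot N}{|X_\theta|^4}\right)+\varphi\varphi_{tt}\left(2\frac{X_{tt}\cdot N}{|X_t|^4}\right)+\varphi\varphi_{t\theta}\left(4\frac{X_{t\theta}\cdot N}{|X_t|^2|X_\theta|^2}\right). \end{aligned}$$
   Context: For a regular parametric surface $Y=Y(t,\theta)$ in $\mathbb{R}^3$ with normal $N_Y=\frac{Y_t\wedge Y_\theta}{|Y_t\wedge Y_\theta|}$, the mean curvature is $\mathfrak{M}(Y)=\frac{\mathcal{E}\mathcal{N}-2\mathcal{F}\mathcal{M}+\mathcal{G}\mathcal{L}}{2(\mathcal{E}\mathcal{G}-\mathcal{F}^2)}$ with $\mathcal{E}=|Y_t|^2$, $\mathcal{F}=Y_t\cdot Y_\theta$, $\mathcal{G}=|Y_\theta|^2$, $\mathcal{L}=Y_{tt}\cdot N_Y$, $\mathcal{M}=Y_{t\theta}\cdot N_Y$, $\mathcal{N}=Y_{\theta\theta}\cdot N_Y$. Subscripts $t,\theta$ denote partial derivatives; $\frac{d}{dt},\frac{d}{d\theta}$ applied to $|X_t|^2,|X_\theta|^2$ are the partial derivatives in $t$, $\theta$. At a fixed point, $\mathfrak{M}(X+s\varphi N)$ is defined for $|s|$ small. *)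

theory Defs
  imports "HOL-Analysis.Analysis"
begin

definition partial_t :: "(real \<times> real \<Rightarrow> 'a::real_normed_vector) \<Rightarrow> real \<times> real \<Rightarrow> 'a"
    (\<open>\<partial>\<^sub>t\<close>) where
  "\<partial>\<^sub>t f p = vector_derivative (\<lambda>t. f (t, snd p)) (at (fst p))"

definition partial_theta :: "(real \<times> real \<Rightarrow> 'a::real_normed_vector) \<Rightarrow> real \<times> real \<Rightarrow> 'a"
    (\<open>\<partial>\<^sub>\<theta>\<close>) where
  "\<partial>\<^sub>\<theta> f p = vector_derivative (\<lambda>\<theta>. f (fst p, \<theta>)) (at (snd p))"

text \<open>The classes \<open>C\<^sup>k(\<Omega>)\<close> and \<open>C\<^sup>\<infinity>(\<Omega>)\<close>, meant for open \<open>\<Omega>\<close>.\<close>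

primrec Ck_on :: "nat \<Rightarrow> (real \<times> real \<Rightarrow> 'a::real_normed_vector) \<Rightarrow> (real \<times> real) set \<Rightarrow> bool" where
  "Ck_on 0 f \<Omega> \<longleftrightarrow> continuous_on \<Omega> f"
| "Ck_on (Suc k) f \<Omega> \<longleftrightarrow> f differentiable_on \<Omega> \<and> Ck_on k (\<partial>\<^sub>t f) \<Omega> \<and> Ck_on k (\<partial>\<^sub>\<theta> f) \<Omega>"

definition smooth_on :: "(real \<times> real \<Rightarrow> 'a::real_normed_vector) \<Rightarrow> (real \<times> real) set \<Rightarrow> bool" where
  "smooth_on f \<Omega> \<longleftrightarrow> (\<forall>k. Ck_on k f \<Omega>)"

definition surface_normal :: "(real \<times> real \<Rightarrow> real^3) \<Rightarrow> real \<times> real \<Rightarrow> real^3" where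
  "surface_normal Y p = cross3 (\<partial>\<^sub>t Y p) (\<partial>\<^sub>\<theta> Y p) /\<^sub>R norm (cross3 (\<partial>\<^sub>t Y p) (\<partial>\<^sub>\<theta> Y p))"

definition mean_curvature :: "(real \<times> real \<Rightarrow> real^3) \<Rightarrow> real \<times> real \<Rightarrow> real" where
  "mean_curvature Y p =
    (let E = (norm (\<partial>\<^sub>t Y p))\<^sup>2;
         F = \<partial>\<^sub>t Y p \<bullet> \<partial>\<^sub>\<theta> Y p;
         G = (norm (\<partial>\<^sub>\<theta> Y p))\<^sup>2;
         L = \<partial>\<^sub>t (\<partial>\<^sub>t Y) p \<bullet> surface_normal Y p;
         M = \<partial>\<^sub>\<theta> (\<partial>\<^sub>t Y) p \<bullet> surface_normal Y p;
         N = \<partial>\<^sub>\<theta> (\<partial>\<^sub>\<theta> Y) p \<bullet> surface_normal Y p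
     in (E * N - 2 * F * M + G * L) / (2 * (E * G - F\<^sup>2)))"

text \<open>\<open>f\<close> is differentiable near \<open>a\<close>, and \<open>f''(a)\<close> exists and equals \<open>D\<close>.\<close>

definition has_second_derivative :: "(real \<Rightarrow> real) \<Rightarrow> real \<Rightarrow> real \<Rightarrow> bool" where
  "has_second_derivative f D a \<longleftrightarrow>
     (\<forall>\<^sub>F s in nhds a. f differentiable (at s)) \<and> (deriv f has_real_derivative D) (at a)"

end

theory Submission
  imports Defs
begin

text \<open>
  At the fixed point, the first and second partial derivatives of \<open>X + s \<phi> N\<close> are affine in \<open>s\<close>, so
  the mean curvature is \<open>P(s) D(s)\<^sup>-\<^sup>3\<^sup>/\<^sup>2 / 2\<close> with polynomials \<open>P\<close> and \<open>D = E G - F\<^sup>2\<close>, and its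
  second derivative only depends on their 2-jets at \<open>0\<close>. The mean curvature is invariant under the
  rescaling of \<open>t\<close> and \<open>\<theta>\<close> that makes \<open>X\<^sub>t, X\<^sub>\<theta>, N\<close> orthonormal at that point; in this frame all
  inner products are expressed through the second fundamental form, the derivatives of \<open>|X\<^sub>t|\<^sup>2\<close>
  and \<open>|X\<^sub>\<theta>|\<^sup>2\<close>, and \<open>N\<^sub>t\<^sub>t\<close>, \<open>N\<^sub>\<theta>\<^sub>\<theta>\<close>, by differentiating \<open>N \<bullet> N = 1\<close>, \<open>N \<bullet> X\<^sub>t = N \<bullet> X\<^sub>\<theta> = 0\<close>
  and \<open>X\<^sub>t \<bullet> X\<^sub>\<theta> = 0\<close> and commuting the mixed partials of \<open>X\<close>. A polynomial identity remains.
\<close>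

subsection \<open>Partial derivatives and the classes \<open>C\<^sup>k\<close>\<close>

text \<open>\<open>vector_derivative\<close> is a choice operator, so
  \<open>\<partial>\<^sub>t\<close> can be computed with only where a derivative exists. Composing
  \<open>f\<close> with the slice map through \<open>q\<close> supplies it by the chain
  rule.\<close>

lemma has_vector_derivative_partial_t:
  assumes "f differentiable (at q)"
  shows "((\<lambda>t. f (t, snd q)) has_vector_derivative \<partial>\<^sub>t f q) (at (fst q))"
proof -
  have "(\<lambda>t. (t, snd q)) differentiable (at (fst q))"
    by (auto simp: differentiable_def intro!: derivative_eq_intros)
  then have "(f \<circ> (\<lambda>t. (t, snd q))) differentiable (at (fst q))"
    by (rule differentiable_chain_at) (use assms in simp)
  then show ?thesis
    by (simp add: o_def partial_t_def flip: vector_derivative_works)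
qed

lemma has_vector_derivative_partial_theta:
  assumes "f differentiable (at q)"
  shows "((\<lambda>\<theta>. f (fst q, \<theta>)) has_vector_derivative \<partial>\<^sub>\<theta> f q) (at (snd q))"
proof -
  have "(\<lambda>\<theta>. (fst q, \<theta>)) differentiable (at (snd q))"
    by (auto simp: differentiable_def intro!: derivative_eq_intros)
  then have "(f \<circ> (\<lambda>\<theta>. (fst q, \<theta>))) differentiable (at (snd q))"
    by (rule differentiable_chain_at) (use assms in simp)
  then show ?thesis
    by (simp add: o_def partial_theta_def flip: vector_derivative_works)
qed

lemma partial_t_eqI:
  assumes "((\<lambda>t. f (t, snd q)) has_vector_derivative D) (at (fst q))"
  shows "\<partial>\<^sub>t f q = D"
  using assms by (simp add: partial_t_def vector_derivative_at)

lemma partial_theta_eqI: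
  assumes "((\<lambda>\<theta>. f (fst q, \<theta>)) has_vector_derivative D) (at (snd q))"
  shows "\<partial>\<^sub>\<theta> f q = D"
  using assms by (simp add: partial_theta_def vector_derivative_at)

lemma eventually_nhds_slices:
  assumes "open \<Omega>" "q \<in> \<Omega>"
  shows "\<forall>\<^sub>F t in nhds (fst q). (t, snd q) \<in> \<Omega>"
    and "\<forall>\<^sub>F \<theta> in nhds (snd q). (fst q, \<theta>) \<in> \<Omega>"
proof -
  have *: "\<forall>\<^sub>F x in nhds q. x \<in> \<Omega>"
    using assms by (auto simp: eventually_nhds)
  have "filterlim (\<lambda>t. (t, snd q)) (nhds q) (nhds (fst q))"
    using tendsto_Pair[OF filterlim_ident[of "nhds (fst q)"] tendsto_const[of "snd q"]] by simp
  from eventually_compose_filterlim[OF * this]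
  show "\<forall>\<^sub>F t in nhds (fst q). (t, snd q) \<in> \<Omega>" .
  have "filterlim (\<lambda>\<theta>. (fst q, \<theta>)) (nhds q) (nhds (snd q))"
    using tendsto_Pair[OF tendsto_const[of "fst q"] filterlim_ident[of "nhds (snd q)"]] by simp
  from eventually_compose_filterlim[OF * this]
  show "\<forall>\<^sub>F \<theta> in nhds (snd q). (fst q, \<theta>) \<in> \<Omega>" .
qed

text \<open>A slice of an open set contains an interval around the base point. This is what permits
  differentiating an identity that is known only on \<Omega>, including a formula for a first
  partial derivative.\<close>

lemma partials_cong:
  assumes "open \<Omega>" "q \<in> \<Omega>" "\<And>x. x \<in> \<Omega> \<Longrightarrow> f x = g x"
  shows "\<partial>\<^sub>t f q = \<partial>\<^sub>t g q" "\<partial>\<^sub>\<theta> f q = \<partial>\<^sub>\<theta> g q"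
  unfolding partial_t_def partial_theta_def
  using eventually_nhds_slices[OF assms(1,2)] assms
  by (auto intro!: vector_derivative_cong_eq elim!: eventually_mono)

lemma partials_const [simp]: "\<partial>\<^sub>t (\<lambda>_. c) q = 0" "\<partial>\<^sub>\<theta> (\<lambda>_. c) q = 0"
  by (auto intro!: partial_t_eqI partial_theta_eqI)

lemma partials_add:
  assumes "f differentiable (at q)" "g differentiable (at q)"
  shows "\<partial>\<^sub>t (\<lambda>q. f q + g q) q = \<partial>\<^sub>t f q + \<partial>\<^sub>t g q"
    and "\<partial>\<^sub>\<theta> (\<lambda>q. f q + g q) q = \<partial>\<^sub>\<theta> f q + \<partial>\<^sub>\<theta> g q"
  using assms
  by (auto intro!: partial_t_eqI partial_theta_eqI has_vector_derivative_add
      has_vector_derivative_partial_t has_vector_derivative_partial_theta)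

text \<open>One Leibniz rule, instantiated below for the inner product, scalar multiplication and
  real multiplication.\<close>

lemma (in bounded_bilinear) partials:
  assumes "f differentiable (at q)" "g differentiable (at q)"
  shows "\<partial>\<^sub>t (\<lambda>q. prod (f q) (g q)) q = prod (f q) (\<partial>\<^sub>t g q) + prod (\<partial>\<^sub>t f q) (g q)"
    and "\<partial>\<^sub>\<theta> (\<lambda>q. prod (f q) (g q)) q = prod (f q) (\<partial>\<^sub>\<theta> g q) + prod (\<partial>\<^sub>\<theta> f q) (g q)"
proof -
  show "\<partial>\<^sub>t (\<lambda>q. prod (f q) (g q)) q = prod (f q) (\<partial>\<^sub>t g q) + prod (\<partial>\<^sub>t f q) (g q)"
    using has_vector_derivative[OF has_vector_derivative_partial_t[OF assms(1)]
        has_vector_derivative_partial_t[OF assms(2)]]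
    by (intro partial_t_eqI) simp
  show "\<partial>\<^sub>\<theta> (\<lambda>q. prod (f q) (g q)) q = prod (f q) (\<partial>\<^sub>\<theta> g q) + prod (\<partial>\<^sub>\<theta> f q) (g q)"
    using has_vector_derivative[OF has_vector_derivative_partial_theta[OF assms(1)]
        has_vector_derivative_partial_theta[OF assms(2)]]
    by (intro partial_theta_eqI) simp
qed

lemmas partials_inner = bounded_bilinear.partials[OF bounded_bilinear_inner]
lemmas partials_scaleR = bounded_bilinear.partials[OF bounded_bilinear_scaleR]
lemmas partials_mult = bounded_bilinear.partials[OF bounded_bilinear_mult]

lemma partials_powr:
  fixes u :: "real \<times> real \<Rightarrow> real"
  assumes "u differentiable (at q)" "u q > 0"
  shows "\<partial>\<^sub>t (\<lambda>q. u q powr r) q = r * (u q powr (r - 1) * \<partial>\<^sub>t u q)"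
    and "\<partial>\<^sub>\<theta> (\<lambda>q. u q powr r) q = r * (u q powr (r - 1) * \<partial>\<^sub>\<theta> u q)"
  using has_vector_derivative_partial_t[OF assms(1)]
    has_vector_derivative_partial_theta[OF assms(1)] assms(2)
  by (auto intro!: partial_t_eqI partial_theta_eqI derivative_eq_intros
      simp flip: has_real_derivative_iff_has_vector_derivative)

section \<open>Closure properties of the classes C^k\<close>

text \<open>The differentiation rules give the partial derivatives of a composite function only at
  points of \<Omega>. The inductions on \<open>k\<close> below therefore exchange functions that
  agree on \<Omega> alone.\<close>

lemma Ck_on_cong:
  assumes "open \<Omega>" "\<And>x. x \<in> \<Omega> \<Longrightarrow> f x = g x" "Ck_on k f \<Omega>"
  shows "Ck_on k g \<Omega>"
  using assms(2,3)
proof (induction k arbitrary: f g)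
  case 0
  then show ?case
    using continuous_on_cong[of \<Omega> \<Omega> f g] by simp
next
  case (Suc k)
  have "g differentiable_on \<Omega>"
    using Suc.prems differentiable_transform_within[of f _ \<Omega> 1 g]
    by (auto simp: differentiable_on_def)
  moreover have "Ck_on k (\<partial>\<^sub>t g) \<Omega>" "Ck_on k (\<partial>\<^sub>\<theta> g) \<Omega>"
    using Suc.prems partials_cong[OF assms(1) _ Suc.prems(1)]
    by (auto intro: Suc.IH[of "\<partial>\<^sub>t f" "\<partial>\<^sub>t g"] Suc.IH[of "\<partial>\<^sub>\<theta> f" "\<partial>\<^sub>\<theta> g"])
  ultimately show ?case by simp
qed

lemma Ck_on_Suc_imp_Ck_on: "Ck_on (Suc k) f \<Omega> \<Longrightarrow> Ck_on k f \<Omega>"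
proof (induction k arbitrary: f)
  case 0
  then show ?case by (simp add: differentiable_imp_continuous_on)
next
  case (Suc k)
  then show ?case
    unfolding Ck_on.simps(2)[of "Suc k"] Ck_on.simps(2)[of k f] by blast
qed

lemma Ck_on_Suc_imp_differentiable_at:
  assumes "Ck_on (Suc k) f \<Omega>" "open \<Omega>" "q \<in> \<Omega>"
  shows "f differentiable (at q)"
  using assms(1,3) at_within_open[OF assms(3,2)] by (simp add: differentiable_on_def) metis

lemma Ck_on_2_imp_differentiable_at:
  assumes "Ck_on 2 f \<Omega>" "open \<Omega>" "q \<in> \<Omega>"
  shows "f differentiable (at q)" "\<partial>\<^sub>t f differentiable (at q)" "\<partial>\<^sub>\<theta> f differentiable (at q)"
  using assms Ck_on_Suc_imp_differentiable_at[of "Suc 0" f \<Omega> q]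
    Ck_on_Suc_imp_differentiable_at[of 0 "\<partial>\<^sub>t f" \<Omega> q]
    Ck_on_Suc_imp_differentiable_at[of 0 "\<partial>\<^sub>\<theta> f" \<Omega> q]
  by (simp_all add: numeral_2_eq_2)

lemma Ck_on_const: "Ck_on k (\<lambda>_. c) \<Omega>"
proof (induction k arbitrary: c)
  case (Suc k)
  have "\<partial>\<^sub>t (\<lambda>_. c) = (\<lambda>_. 0)" "\<partial>\<^sub>\<theta> (\<lambda>_. c) = (\<lambda>_. 0)"
    by auto
  with Suc[of 0] show ?case by simp
qed simp

lemma Ck_on_add:
  assumes "open \<Omega>" "Ck_on k f \<Omega>" "Ck_on k g \<Omega>"
  shows "Ck_on k (\<lambda>q. f q + g q) \<Omega>"
  using assms(2,3)
proof (induction k arbitrary: f g)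
  case 0
  then show ?case by (auto intro: continuous_on_add)
next
  case (Suc k)
  have d: "f differentiable (at q)" "g differentiable (at q)" if "q \<in> \<Omega>" for q
    using Ck_on_Suc_imp_differentiable_at assms(1) Suc.prems that by blast+
  have "Ck_on k (\<lambda>q. \<partial>\<^sub>t f q + \<partial>\<^sub>t g q) \<Omega>" "Ck_on k (\<lambda>q. \<partial>\<^sub>\<theta> f q + \<partial>\<^sub>\<theta> g q) \<Omega>"
    using Suc by auto
  then have "Ck_on k (\<partial>\<^sub>t (\<lambda>q. f q + g q)) \<Omega>" "Ck_on k (\<partial>\<^sub>\<theta> (\<lambda>q. f q + g q)) \<Omega>"
    by (auto intro: Ck_on_cong[OF assms(1), rotated] simp: partials_add d)
  with Suc.prems show ?case by auto
qed

text \<open>Induction through the Leibniz rule. Each term contains one undifferentiated factor, so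
  the hypothesis for \<open>Suc k\<close> is also weakened to \<open>k\<close>.\<close>

lemma (in bounded_bilinear) Ck_on:
  assumes "open \<Omega>" "Ck_on k f \<Omega>" "Ck_on k g \<Omega>"
  shows "Ck_on k (\<lambda>q. prod (f q) (g q)) \<Omega>"
  using assms(2,3)
proof (induction k arbitrary: f g)
  case 0
  then show ?case by (auto intro: continuous_on)
next
  case (Suc k)
  have d: "f differentiable (at q)" "g differentiable (at q)" if "q \<in> \<Omega>" for q
    using Ck_on_Suc_imp_differentiable_at assms(1) Suc.prems that by blast+
  have "Ck_on k f \<Omega>" "Ck_on k g \<Omega>"
    using Suc.prems Ck_on_Suc_imp_Ck_on by blast+
  then have "Ck_on k (\<lambda>q. prod (f q) (\<partial>\<^sub>t g q) + prod (\<partial>\<^sub>t f q) (g q)) \<Omega>"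
      "Ck_on k (\<lambda>q. prod (f q) (\<partial>\<^sub>\<theta> g q) + prod (\<partial>\<^sub>\<theta> f q) (g q)) \<Omega>"
    using Suc by (auto intro!: Ck_on_add assms(1))
  then have "Ck_on k (\<partial>\<^sub>t (\<lambda>q. prod (f q) (g q))) \<Omega>" "Ck_on k (\<partial>\<^sub>\<theta> (\<lambda>q. prod (f q) (g q))) \<Omega>"
    by (auto intro: Ck_on_cong[OF assms(1), rotated] simp: partials d)
  moreover have "(\<lambda>q. prod (f q) (g q)) differentiable_on \<Omega>"
    unfolding differentiable_on_def
  proof
    fix q assume q: "q \<in> \<Omega>"
    then obtain f' g' where "(f has_derivative f') (at q within \<Omega>)" "(g has_derivative g') (at q within \<Omega>)"
      using Suc.prems unfolding Ck_on.simps differentiable_on_def differentiable_def by blast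
    from FDERIV[OF this] show "(\<lambda>q. prod (f q) (g q)) differentiable (at q within \<Omega>)"
      by (auto simp: differentiable_def)
  qed
  ultimately show ?case by simp
qed

text \<open>Differentiating a real power of \<open>u\<close> gives a lower real power times a
  derivative of \<open>u\<close>, so the induction leaves \<open>r\<close> arbitrary. The exponent
  -1/2 later normalises the normal vector.\<close>

lemma Ck_on_powr:
  fixes u :: "real \<times> real \<Rightarrow> real"
  assumes "open \<Omega>" "Ck_on k u \<Omega>" "\<And>q. q \<in> \<Omega> \<Longrightarrow> u q > 0"
  shows "Ck_on k (\<lambda>q. u q powr r) \<Omega>"
  using assms(2)
proof (induction k arbitrary: r)
  case 0
  then show ?case
    using assms(3) by (auto intro!: continuous_on_powr) (metis less_irrefl)
next
  case (Suc k)
  have d: "u differentiable (at q)" if "q \<in> \<Omega>" for q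
    using Ck_on_Suc_imp_differentiable_at assms(1) Suc.prems that by blast
  have "Ck_on k (\<lambda>q. u q powr (r - 1)) \<Omega>"
    using Suc Ck_on_Suc_imp_Ck_on by blast
  then have "Ck_on k (\<lambda>q. r * (u q powr (r - 1) * \<partial>\<^sub>t u q)) \<Omega>"
      "Ck_on k (\<lambda>q. r * (u q powr (r - 1) * \<partial>\<^sub>\<theta> u q)) \<Omega>"
    using Suc by (auto intro!: bounded_bilinear.Ck_on[OF bounded_bilinear_mult] Ck_on_const assms(1))
  then have "Ck_on k (\<partial>\<^sub>t (\<lambda>q. u q powr r)) \<Omega>" "Ck_on k (\<partial>\<^sub>\<theta> (\<lambda>q. u q powr r)) \<Omega>"
    by (auto intro: Ck_on_cong[OF assms(1), rotated] simp: partials_powr d assms(3))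
  moreover have "(\<lambda>q. u q powr r) differentiable_on \<Omega>"
    unfolding differentiable_on_def
  proof
    fix q assume q: "q \<in> \<Omega>"
    then obtain u' where "(u has_derivative u') (at q)"
      using d unfolding differentiable_def by blast
    from has_derivative_powr[OF this has_derivative_const[of r] assms(3)[OF q]]
    show "(\<lambda>q. u q powr r) differentiable (at q within \<Omega>)"
      unfolding at_within_open[OF q assms(1)] differentiable_def by blast
  qed
  ultimately show ?case by simp
qed

section \<open>Symmetry of mixed partial derivatives\<close>

text \<open>The mean value theorem is applied twice: to \<open>F x (b+h) - F x b\<close> as a
  function of \<open>x\<close>, then to \<open>Fx \<xi>\<close> as a function of
  \<open>y\<close>.\<close>

lemma second_difference_mean_value:
  fixes F Fx Fxy :: "real \<Rightarrow> real \<Rightarrow> real"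
  assumes "h > 0"
    and x: "\<And>x y. x \<in> {a..a+h} \<Longrightarrow> y \<in> {b..b+h} \<Longrightarrow> ((\<lambda>x. F x y) has_real_derivative Fx x y) (at x)"
    and xy: "\<And>x y. x \<in> {a..a+h} \<Longrightarrow> y \<in> {b..b+h} \<Longrightarrow> (Fx x has_real_derivative Fxy x y) (at y)"
  shows "\<exists>\<xi>\<in>{a..a+h}. \<exists>\<eta>\<in>{b..b+h}.
    F (a+h) (b+h) - F (a+h) b - F a (b+h) + F a b = h * h * Fxy \<xi> \<eta>"
proof -
  have "\<exists>\<xi>>a. \<xi> < a+h \<and> (F (a+h) (b+h) - F (a+h) b) - (F a (b+h) - F a b) =
      (a+h-a) * (Fx \<xi> (b+h) - Fx \<xi> b)"
    using \<open>h > 0\<close> by (intro MVT2) (auto intro!: DERIV_diff x)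
  then obtain \<xi> where \<xi>: "a < \<xi>" "\<xi> < a+h"
    "(F (a+h) (b+h) - F (a+h) b) - (F a (b+h) - F a b) = h * (Fx \<xi> (b+h) - Fx \<xi> b)"
    by auto
  have "\<exists>\<eta>>b. \<eta> < b+h \<and> Fx \<xi> (b+h) - Fx \<xi> b = (b+h-b) * Fxy \<xi> \<eta>"
    using \<open>h > 0\<close> \<xi> by (intro MVT2) (auto intro!: xy)
  then obtain \<eta> where "b < \<eta>" "\<eta> < b+h" "Fx \<xi> (b+h) - Fx \<xi> b = h * Fxy \<xi> \<eta>"
    by auto
  with \<xi> show ?thesis
    by (intro bexI[of _ \<xi>] bexI[of _ \<eta>]) (auto simp: algebra_simps)
qed

text \<open>The second difference over a small square does not depend on the order of the variables,
  yet it equals \<open>h * h\<close> times either mixed partial at some point of the square.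
  Continuity at \<open>q\<close> then excludes a gap between the two values.\<close>

lemma mixed_partials_commute_real:
  fixes f :: "real \<times> real \<Rightarrow> real"
  assumes "open \<Omega>" "Ck_on 2 f \<Omega>" "q \<in> \<Omega>"
  shows "\<partial>\<^sub>\<theta> (\<partial>\<^sub>t f) q = \<partial>\<^sub>t (\<partial>\<^sub>\<theta> f) q"
proof (rule ccontr)
  let ?A = "\<partial>\<^sub>\<theta> (\<partial>\<^sub>t f)" and ?B = "\<partial>\<^sub>t (\<partial>\<^sub>\<theta> f)"
  assume "?A q \<noteq> ?B q"
  \<comment> \<open>Half the gap: two errors below \<open>e\<close> cannot bridge it.\<close>
  define e where "e = \<bar>?A q - ?B q\<bar> / 2"
  have "e > 0" using \<open>?A q \<noteq> ?B q\<close> by (simp add: e_def)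
  have f: "\<forall>x\<in>\<Omega>. f differentiable (at x)" "\<forall>x\<in>\<Omega>. \<partial>\<^sub>t f differentiable (at x)"
    "\<forall>x\<in>\<Omega>. \<partial>\<^sub>\<theta> f differentiable (at x)"
    using Ck_on_2_imp_differentiable_at[OF assms(2,1)] by blast+
  have "isCont ?A q" "isCont ?B q"
    using assms by (auto simp: numeral_2_eq_2 continuous_on_eq_continuous_at)
  then obtain d1 d2 where d: "d1 > 0" "d2 > 0"
    "\<And>x. dist x q < d1 \<Longrightarrow> dist (?A x) (?A q) < e"
    "\<And>x. dist x q < d2 \<Longrightarrow> dist (?B x) (?B q) < e"
    using \<open>e > 0\<close> unfolding continuous_at_eps_delta by metis
  obtain d3 where d3: "d3 > 0" "ball q d3 \<subseteq> \<Omega>"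
    using assms(1,3) openE by blast
  \<comment> \<open>Points of the square lie within 2h of its corner \<open>q\<close> in the sum
    norm, hence at Euclidean distance strictly below 3h, which is at most each of the three
    radii.\<close>
  define h where "h = Min {d1, d2, d3} / 3"
  have h: "h > 0" "3 * h \<le> d1" "3 * h \<le> d2" "3 * h \<le> d3"
    using d d3 by (auto simp: h_def)
  obtain a b where q: "q = (a, b)" by (cases q)
  have near: "dist (x, y) q < 3 * h" if "x \<in> {a..a+h}" "y \<in> {b..b+h}" for x y
  proof -
    have "dist (x, y) q \<le> \<bar>x - a\<bar> + \<bar>y - b\<bar>"
      by (simp add: q dist_Pair_Pair dist_real_def sqrt_sum_squares_le_sum_abs)
    with that h(1) show ?thesis by auto
  qed
  then have in\<Omega>: "(x, y) \<in> \<Omega>" if "x \<in> {a..a+h}" "y \<in> {b..b+h}" for x y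
    using d3(2) h(4) that by (force simp: dist_commute)
  have dt: "((\<lambda>x. g (x, y)) has_real_derivative \<partial>\<^sub>t g (x, y)) (at x)"
    and dth: "((\<lambda>y. g (x, y)) has_real_derivative \<partial>\<^sub>\<theta> g (x, y)) (at y)"
    if "\<forall>x\<in>\<Omega>. g differentiable (at x)" "x \<in> {a..a+h}" "y \<in> {b..b+h}"
    for g :: "real \<times> real \<Rightarrow> real" and x y
  proof -
    have "g differentiable (at (x, y))"
      using that in\<Omega> by blast
    from has_vector_derivative_partial_t[OF this] has_vector_derivative_partial_theta[OF this]
    show "((\<lambda>x. g (x, y)) has_real_derivative \<partial>\<^sub>t g (x, y)) (at x)"
      "((\<lambda>y. g (x, y)) has_real_derivative \<partial>\<^sub>\<theta> g (x, y)) (at y)"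
      by (auto simp: has_real_derivative_iff_has_vector_derivative)
  qed
  obtain \<xi> \<eta> where 1: "\<xi> \<in> {a..a+h}" "\<eta> \<in> {b..b+h}"
    "f (a+h, b+h) - f (a+h, b) - f (a, b+h) + f (a, b) = h * h * ?A (\<xi>, \<eta>)"
    using second_difference_mean_value[of h a b "\<lambda>x y. f (x, y)" "\<lambda>x y. \<partial>\<^sub>t f (x, y)"
        "\<lambda>x y. ?A (x, y)", OF h(1) dt[OF f(1)] dth[OF f(2)]] by blast
  \<comment> \<open>The same second difference, with the two variables exchanged.\<close>
  obtain \<eta>' \<xi>' where 2: "\<eta>' \<in> {b..b+h}" "\<xi>' \<in> {a..a+h}"
    "f (a+h, b+h) - f (a, b+h) - f (a+h, b) + f (a, b) = h * h * ?B (\<xi>', \<eta>')"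
    using second_difference_mean_value[of h b a "\<lambda>y x. f (x, y)" "\<lambda>y x. \<partial>\<^sub>\<theta> f (x, y)"
        "\<lambda>y x. ?B (x, y)", OF h(1) dth[OF f(1)] dt[OF f(3)]] by blast
  have "h * h * ?A (\<xi>, \<eta>) = h * h * ?B (\<xi>', \<eta>')"
    using 1(3) 2(3) by linarith
  then have "?A (\<xi>, \<eta>) = ?B (\<xi>', \<eta>')"
    using h(1) by simp
  moreover have "dist (?A (\<xi>, \<eta>)) (?A q) < e" "dist (?B (\<xi>', \<eta>')) (?B q) < e"
    using near[OF 1(1,2)] near[OF 2(2,1)] h d(3)[of "(\<xi>, \<eta>)"] d(4)[of "(\<xi>', \<eta>')"] by simp_all
  ultimately have "dist (?A q) (?B q) < 2 * e"
    using dist_triangle3[of "?A q" "?B q" "?A (\<xi>, \<eta>)"] by simp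
  then show False
    by (simp add: e_def dist_real_def)
qed

text \<open>Testing against an arbitrary vector \<open>v\<close> reduces the claim to the
  real-valued function \<open>v \<bullet> f x\<close>.\<close>

lemma mixed_partials_commute:
  fixes f :: "real \<times> real \<Rightarrow> 'a::real_inner"
  assumes "open \<Omega>" "Ck_on 2 f \<Omega>" "q \<in> \<Omega>"
  shows "\<partial>\<^sub>\<theta> (\<partial>\<^sub>t f) q = \<partial>\<^sub>t (\<partial>\<^sub>\<theta> f) q"
proof (rule vector_eq_ldot[THEN iffD1, rule_format])
  fix v :: 'a
  note f = Ck_on_2_imp_differentiable_at[OF assms(2,1)]
  have "\<partial>\<^sub>\<theta> (\<partial>\<^sub>t (\<lambda>x. v \<bullet> f x)) q = \<partial>\<^sub>t (\<partial>\<^sub>\<theta> (\<lambda>x. v \<bullet> f x)) q"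
    using assms by (intro mixed_partials_commute_real[of \<Omega>]
        bounded_bilinear.Ck_on[OF bounded_bilinear_inner] Ck_on_const)
  moreover have "\<partial>\<^sub>\<theta> (\<partial>\<^sub>t (\<lambda>x. v \<bullet> f x)) q = \<partial>\<^sub>\<theta> (\<lambda>x. v \<bullet> \<partial>\<^sub>t f x) q"
    by (rule partials_cong(2)[OF assms(1,3)]) (simp add: partials_inner f)
  moreover have "\<partial>\<^sub>t (\<partial>\<^sub>\<theta> (\<lambda>x. v \<bullet> f x)) q = \<partial>\<^sub>t (\<lambda>x. v \<bullet> \<partial>\<^sub>\<theta> f x) q"
    by (rule partials_cong(1)[OF assms(1,3)]) (simp add: partials_inner f)
  ultimately show "v \<bullet> \<partial>\<^sub>\<theta> (\<partial>\<^sub>t f) q = v \<bullet> \<partial>\<^sub>t (\<partial>\<^sub>\<theta> f) q"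
    using f assms(3) by (simp add: partials_inner)
qed

subsection \<open>Second-order jets\<close>

text \<open>The entries are derivatives, not Taylor coefficients. An explicit derivative
  \<open>f'\<close> near 0 is used in place of \<open>deriv f\<close>, so that sums, products and
  powers of jets can be formed by exhibiting the new derivative.\<close>

definition has_jet2 :: "(real \<Rightarrow> real) \<Rightarrow> real \<Rightarrow> real \<Rightarrow> real \<Rightarrow> bool" where
  "has_jet2 f c0 c1 c2 \<longleftrightarrow> f 0 = c0 \<and>
     (\<exists>f'. (\<forall>\<^sub>F s in nhds 0. (f has_real_derivative f' s) (at s)) \<and> f' 0 = c1 \<and>
           (f' has_real_derivative c2) (at 0))"

lemma has_jet2_imp_has_second_derivative:
  assumes "has_jet2 f c0 c1 c2"
  shows "has_second_derivative f c2 0"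
proof -
  obtain f' where f': "\<forall>\<^sub>F s in nhds 0. (f has_real_derivative f' s) (at s)"
    "(f' has_real_derivative c2) (at 0)"
    using assms by (auto simp: has_jet2_def)
  have "\<forall>\<^sub>F s in nhds 0. f differentiable (at s)"
    using f'(1) by eventually_elim (auto simp: real_differentiable_def)
  moreover have "\<forall>\<^sub>F s in nhds 0. deriv f s = f' s"
    using f'(1) by eventually_elim (rule DERIV_imp_deriv)
  then have "(deriv f has_real_derivative c2) (at 0)"
    using f'(2) DERIV_cong_ev[OF refl _ refl] by blast
  ultimately show ?thesis
    by (simp add: has_second_derivative_def)
qed

text \<open>Degree three suffices for every polynomial ingredient: inner products of affine vectors
  are quadratic in \<open>s\<close>, and triple products are cubic.\<close>

lemma has_jet2_cubic:
  "has_jet2 (\<lambda>s. c0 + c1 * s + c2 * s\<^sup>2 + c3 * s ^ 3) c0 c1 (2 * c2)"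
  unfolding has_jet2_def
  by (intro conjI exI[of _ "\<lambda>s. c1 + 2 * c2 * s + 3 * c3 * s\<^sup>2"] always_eventually allI)
    (auto intro!: derivative_eq_intros)

lemma has_jet2_eq_rhs:
  "has_jet2 f a0 a1 a2 \<Longrightarrow> a0 = b0 \<Longrightarrow> a1 = b1 \<Longrightarrow> a2 = b2 \<Longrightarrow> has_jet2 f b0 b1 b2"
  by simp

lemma has_jet2_const: "has_jet2 (\<lambda>_. c) c 0 0"
  using has_jet2_cubic[of c 0 0 0] by simp

lemma has_jet2_add:
  assumes "has_jet2 f a0 a1 a2" "has_jet2 g b0 b1 b2"
  shows "has_jet2 (\<lambda>s. f s + g s) (a0 + b0) (a1 + b1) (a2 + b2)"
proof -
  obtain f' g' where *: "\<forall>\<^sub>F s in nhds 0. (f has_real_derivative f' s) (at s)"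
    "\<forall>\<^sub>F s in nhds 0. (g has_real_derivative g' s) (at s)"
    "(f' has_real_derivative a2) (at 0)" "(g' has_real_derivative b2) (at 0)"
    "f' 0 = a1" "g' 0 = b1"
    using assms by (auto simp: has_jet2_def)
  have "\<forall>\<^sub>F s in nhds 0. ((\<lambda>s. f s + g s) has_real_derivative f' s + g' s) (at s)"
    using *(1,2) by eventually_elim (rule DERIV_add)
  with * show ?thesis
    using assms unfolding has_jet2_def
    by (intro conjI exI[of _ "\<lambda>s. f' s + g' s"]) (auto intro: DERIV_add)
qed

lemma has_jet2_mult:
  assumes "has_jet2 f a0 a1 a2" "has_jet2 g b0 b1 b2"
  shows "has_jet2 (\<lambda>s. f s * g s) (a0 * b0) (a1 * b0 + a0 * b1) (a2 * b0 + 2 * a1 * b1 + a0 * b2)"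
proof -
  obtain f' g' where *: "\<forall>\<^sub>F s in nhds 0. (f has_real_derivative f' s) (at s)"
    "\<forall>\<^sub>F s in nhds 0. (g has_real_derivative g' s) (at s)"
    "(f' has_real_derivative a2) (at 0)" "(g' has_real_derivative b2) (at 0)"
    "f' 0 = a1" "g' 0 = b1" "f 0 = a0" "g 0 = b0"
    using assms by (auto simp: has_jet2_def)
  have "\<forall>\<^sub>F s in nhds 0. ((\<lambda>s. f s * g s) has_real_derivative f' s * g s + f s * g' s) (at s)"
    using *(1,2) by eventually_elim (auto intro!: derivative_eq_intros)
  moreover have "(f has_real_derivative a1) (at 0)" "(g has_real_derivative b1) (at 0)"
    using eventually_nhds_x_imp_x[OF *(1)] eventually_nhds_x_imp_x[OF *(2)] *(5,6) by auto
  then have "((\<lambda>s. f' s * g s + f s * g' s) has_real_derivative a2 * b0 + 2 * a1 * b1 + a0 * b2) (at 0)"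
    using * by (auto intro!: derivative_eq_intros)
  ultimately show ?thesis
    using * unfolding has_jet2_def
    by (intro conjI exI[of _ "\<lambda>s. f' s * g s + f s * g' s"]) auto
qed

text \<open>The value 1 at the origin makes all powers of \<open>u 0\<close> equal to 1. The
  determinant E G - F^2 has this value in an orthonormal frame.\<close>

lemma has_jet2_powr:
  assumes "has_jet2 u 1 u1 u2"
  shows "has_jet2 (\<lambda>s. u s powr r) 1 (r * u1) (r * (r - 1) * u1\<^sup>2 + r * u2)"
proof -
  obtain u' where *: "\<forall>\<^sub>F s in nhds 0. (u has_real_derivative u' s) (at s)"
    "(u' has_real_derivative u2) (at 0)" "u' 0 = u1" "u 0 = 1"
    using assms by (auto simp: has_jet2_def)
  have u1: "(u has_real_derivative u1) (at 0)"
    using eventually_nhds_x_imp_x[OF *(1)] *(3) by simp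
  \<comment> \<open>Continuity keeps \<open>u\<close> positive near 0, where the power rule is
    available.\<close>
  then have "(u \<longlongrightarrow> 1) (nhds 0)"
    using DERIV_isCont isCont_def *(4) tendsto_at_iff_tendsto_nhds by metis
  then have "\<forall>\<^sub>F s in nhds 0. u s > 0"
    using order_tendstoD(1) zero_less_one by blast
  with *(1) have "\<forall>\<^sub>F s in nhds 0. ((\<lambda>s. u s powr r) has_real_derivative r * u s powr (r - 1) * u' s) (at s)"
    by eventually_elim (auto intro!: derivative_eq_intros)
  moreover have "((\<lambda>s. r * u s powr (r - 1) * u' s) has_real_derivative
      r * (r - 1) * u1\<^sup>2 + r * u2) (at 0)"
    using * u1 by (auto intro!: derivative_eq_intros simp: power2_eq_square)
  ultimately show ?thesis
    using * unfolding has_jet2_def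
    by (intro conjI exI[of _ "\<lambda>s. r * u s powr (r - 1) * u' s"]) auto
qed

subsection \<open>Mean curvature in an orthonormal frame\<close>

text \<open>The right-hand side is the determinant of the mixed Gram matrix of (x, u, v) and (y, u,
  v), expanded along its first row; the left-hand side is the product of the two
  determinants.\<close>

lemma inner_cross_product_frame:
  fixes x y u v :: "real^3"
  shows "(x \<bullet> cross3 u v) * (y \<bullet> cross3 u v) =
    (x \<bullet> y) * ((u \<bullet> u) * (v \<bullet> v) - (u \<bullet> v)\<^sup>2)
    - (x \<bullet> u) * ((u \<bullet> y) * (v \<bullet> v) - (u \<bullet> v) * (v \<bullet> y))
    + (x \<bullet> v) * ((u \<bullet> y) * (u \<bullet> v) - (u \<bullet> u) * (v \<bullet> y))"
  by (simp add: cross3_simps power2_eq_square)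

text \<open>Since \<open>|u \<times> v|\<^sup>2 = E G - F\<^sup>2\<close>, normalising the normal contributes a further factor
  \<open>(E G - F\<^sup>2) powr (- 1 / 2)\<close>.\<close>

definition mean_curvature_of :: "real^3 \<Rightarrow> real^3 \<Rightarrow> real^3 \<Rightarrow> real^3 \<Rightarrow> real^3 \<Rightarrow> real" where
  "mean_curvature_of u v x y z =
    ((u \<bullet> u) * (z \<bullet> cross3 u v) - 2 * (u \<bullet> v) * (y \<bullet> cross3 u v) + (v \<bullet> v) * (x \<bullet> cross3 u v)) / 2
    * ((u \<bullet> u) * (v \<bullet> v) - (u \<bullet> v)\<^sup>2) powr (- 3 / 2)"

lemma norm_cross3_eq: "norm (cross3 u v) = sqrt ((u \<bullet> u) * (v \<bullet> v) - (u \<bullet> v)\<^sup>2)"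
proof -
  have "(norm (cross3 u v))\<^sup>2 = (u \<bullet> u) * (v \<bullet> v) - (u \<bullet> v)\<^sup>2"
    using norm_cross_dot[of u v] by (simp add: power_mult_distrib power2_norm_eq_inner)
  then show ?thesis
    by (metis norm_ge_zero real_sqrt_unique)
qed

lemma mean_curvature_eq:
  "mean_curvature Y p =
    mean_curvature_of (\<partial>\<^sub>t Y p) (\<partial>\<^sub>\<theta> Y p) (\<partial>\<^sub>t (\<partial>\<^sub>t Y) p) (\<partial>\<^sub>\<theta> (\<partial>\<^sub>t Y) p) (\<partial>\<^sub>\<theta> (\<partial>\<^sub>\<theta> Y) p)"
proof -
  define u v where "u = \<partial>\<^sub>t Y p" and "v = \<partial>\<^sub>\<theta> Y p"
  define D where "D = (u \<bullet> u) * (v \<bullet> v) - (u \<bullet> v)\<^sup>2"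
  have C: "norm (cross3 u v) = sqrt D"
    by (simp add: norm_cross3_eq D_def)
  then have "D \<ge> 0"
    by (metis norm_ge_zero real_sqrt_ge_0_iff)
  then consider "D = 0" | "D > 0" by linarith
  then show ?thesis
  proof cases
    \<comment> \<open>In the degenerate case both sides are 0, by the conventions for division by 0
      and for \<open>0 powr r\<close>. The equation thus holds for every \<open>s\<close> without a
      regularity condition.\<close>
    case 1
    then show ?thesis
      using C by (simp add: mean_curvature_def mean_curvature_of_def surface_normal_def
          u_def[symmetric] v_def[symmetric] D_def)
  next
    case 2
    have "D powr (- 3 / 2) = D powr (- 1) * D powr (- (1 / 2))"
      unfolding powr_add[symmetric] by simp
    also have "\<dots> = 1 / (D * sqrt D)"
      using 2 by (simp add: powr_minus powr_half_sqrt divide_simps)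
    finally have D_powr: "D powr (- 3 / 2) = 1 / (D * sqrt D)" .
    show ?thesis
      using 2 unfolding mean_curvature_def mean_curvature_of_def surface_normal_def Let_def
        u_def[symmetric] v_def[symmetric] C power2_norm_eq_inner D_def[symmetric] D_powr
      by (simp add: field_simps)
  qed
qed

text \<open>Invariance under linear rescaling of the two parameters: the numerator acquires the
  factor (a b)^3 and the determinant the factor (a b)^2, whose power -3/2 cancels it.\<close>

lemma mean_curvature_of_scale:
  assumes "a > 0" "b > 0"
  shows "mean_curvature_of (a *\<^sub>R u) (b *\<^sub>R v) (a\<^sup>2 *\<^sub>R x) ((a * b) *\<^sub>R y) (b\<^sup>2 *\<^sub>R z) =
    mean_curvature_of u v x y z"
proof -
  define D where "D = (u \<bullet> u) * (v \<bullet> v) - (u \<bullet> v)\<^sup>2"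
  have "((a * b)\<^sup>2) powr (- 3 / 2) = ((a * b) powr 2) powr (- 3 / 2)"
    using assms by (simp add: powr_numeral)
  also have "\<dots> = (a * b) powr (- 3)"
    by (simp only: powr_powr) simp
  also have "\<dots> = 1 / (a * b) ^ 3"
    using assms by (simp add: powr_minus powr_numeral divide_simps)
  finally have "((a * b)\<^sup>2 * D) powr (- 3 / 2) = D powr (- 3 / 2) / (a * b) ^ 3"
    by (simp add: powr_mult)
  moreover have "(a *\<^sub>R u \<bullet> a *\<^sub>R u) * (b *\<^sub>R v \<bullet> b *\<^sub>R v) - (a *\<^sub>R u \<bullet> b *\<^sub>R v)\<^sup>2 = (a * b)\<^sup>2 * D"
    by (simp add: D_def algebra_simps power2_eq_square)
  ultimately show ?thesis
    unfolding mean_curvature_of_def D_def[symmetric] using assms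
    by (simp add: cross_mult_left cross_mult_right) (simp add: field_simps power2_eq_square power3_eq_cube)
qed

section \<open>Coordinates in an orthonormal frame\<close>

locale orthonormal_pair =
  fixes e1 e2 :: "real^3"
  assumes e11: "e1 \<bullet> e1 = 1" and e22: "e2 \<bullet> e2 = 1" and e12: "e1 \<bullet> e2 = 0"
begin

abbreviation "e3 \<equiv> cross3 e1 e2"

text \<open>For an orthonormal pair the Gram determinant identity reduces to Parseval's formula, so
  completeness of the frame needs no dimension argument.\<close>

lemma inner_expand: "x \<bullet> y = (x \<bullet> e1) * (y \<bullet> e1) + (x \<bullet> e2) * (y \<bullet> e2) + (x \<bullet> e3) * (y \<bullet> e3)"
  using inner_cross_product_frame[of x e1 e2 y] e11 e22 e12 by (simp add: inner_commute)

text \<open>The determinant in frame coordinates. Since \<open>e1\<close> and \<open>e2\<close> are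
  themselves cross products of frame vectors, the Binet-Cauchy identity \<open>c\<close> gives every
  coordinate of \<open>cross3 y z\<close>.\<close>

lemma triple_expand:
  "x \<bullet> cross3 y z =
     (x \<bullet> e1) * ((y \<bullet> e2) * (z \<bullet> e3) - (y \<bullet> e3) * (z \<bullet> e2))
   + (x \<bullet> e2) * ((y \<bullet> e3) * (z \<bullet> e1) - (y \<bullet> e1) * (z \<bullet> e3))
   + (x \<bullet> e3) * ((y \<bullet> e1) * (z \<bullet> e2) - (y \<bullet> e2) * (z \<bullet> e1))"
proof -
  have c: "cross3 a b \<bullet> cross3 c d = (a \<bullet> c) * (b \<bullet> d) - (a \<bullet> d) * (b \<bullet> c)" for a b c d :: "real^3"
    by (simp add: cross3_simps)
  have "cross3 e2 e3 = e1" "cross3 e3 e1 = e2"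
    using Lagrange[of e2 e1 e2] Lagrange[of e1 e1 e2] e11 e22 e12 cross_skew[of e3 e1]
    by (simp_all add: inner_commute)
  then have "cross3 y z \<bullet> e1 = (y \<bullet> e2) * (z \<bullet> e3) - (y \<bullet> e3) * (z \<bullet> e2)"
    "cross3 y z \<bullet> e2 = (y \<bullet> e3) * (z \<bullet> e1) - (y \<bullet> e1) * (z \<bullet> e3)"
    using c[of y z e2 e3] c[of y z e3 e1] by simp_all
  then show ?thesis
    using c[of y z e1 e2] by (subst inner_expand) simp
qed

lemma frame_simps [simp]:
  "e1 \<bullet> e1 = 1" "e2 \<bullet> e2 = 1" "e1 \<bullet> e2 = 0" "e2 \<bullet> e1 = 0"
  "e1 \<bullet> e3 = 0" "e2 \<bullet> e3 = 0"
  using e11 e22 e12 by (simp_all add: inner_commute dot_cross_self)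

text \<open>By multilinearity the triple product is a cubic in \<open>s\<close>; its top coefficient
  does not enter the jet. Applied to the three second derivatives of the surface, this yields the
  unnormalised coefficients L, M and N.\<close>

lemma has_jet2_triple:
  fixes V W A A' :: "real^3"
  defines "x \<equiv> A \<bullet> e1" and "y \<equiv> A \<bullet> e2" and "z \<equiv> A \<bullet> e3"
    and "x' \<equiv> A' \<bullet> e1" and "y' \<equiv> A' \<bullet> e2" and "z' \<equiv> A' \<bullet> e3"
    and "p1 \<equiv> V \<bullet> e1" and "p2 \<equiv> V \<bullet> e2" and "p3 \<equiv> V \<bullet> e3"
    and "q1 \<equiv> W \<bullet> e1" and "q2 \<equiv> W \<bullet> e2" and "q3 \<equiv> W \<bullet> e3"
  shows "has_jet2 (\<lambda>s. (A + s *\<^sub>R A') \<bullet> cross3 (e1 + s *\<^sub>R V) (e2 + s *\<^sub>R W))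
    z (z' + z * (p1 + q2) - x * p3 - y * q3)
    (2 * (z' * (p1 + q2) - x' * p3 - y' * q3 + z * (p1 * q2 - p2 * q1)
          + x * (p2 * q3 - p3 * q2) + y * (p3 * q1 - p1 * q3)))"
proof -
  have *: "(A + s *\<^sub>R A') \<bullet> cross3 (e1 + s *\<^sub>R V) (e2 + s *\<^sub>R W) =
     A \<bullet> e3 + (A' \<bullet> e3 + A \<bullet> cross3 e1 W + A \<bullet> cross3 V e2) * s
     + (A' \<bullet> cross3 e1 W + A' \<bullet> cross3 V e2 + A \<bullet> cross3 V W) * s\<^sup>2 + (A' \<bullet> cross3 V W) * s ^ 3" for s
    by (simp add: cross_add_left cross_add_right cross_mult_left cross_mult_right inner_simps
        algebra_simps power2_eq_square power3_eq_cube)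
  \<comment> \<open>With a frame vector in one slot only two terms of the determinant
    survive.\<close>
  have eVW: "B \<bullet> cross3 e1 W = (B \<bullet> e3) * q2 - (B \<bullet> e2) * q3"
    "B \<bullet> cross3 V e2 = (B \<bullet> e3) * p1 - (B \<bullet> e1) * p3" for B
    unfolding assms triple_expand[of B e1 W] triple_expand[of B V e2]
    by (simp_all add: algebra_simps)
  show ?thesis
    unfolding *
    by (rule has_jet2_eq_rhs[OF has_jet2_cubic])
      (simp_all add: eVW triple_expand[of A V W] x_def y_def z_def x'_def y'_def z'_def
        p1_def p2_def p3_def q1_def q2_def q3_def algebra_simps)
qed

text \<open>The components of \<open>B'\<close> along \<open>e1\<close> and \<open>e2\<close> do not matter: they enter \<open>B \<bullet> (u \<times> v)\<close> only at
  order \<open>s\<^sup>2\<close>, and the factor \<open>F\<close> in front of it vanishes at \<open>s = 0\<close>.\<close>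

lemma has_second_derivative_mean_curvature_of:
  fixes V W A A' B B' K K' :: "real^3" and f f1 f2 l m g :: real
  assumes V: "V \<bullet> e1 = - f * l" "V \<bullet> e2 = - f * m" "V \<bullet> e3 = f1"
    and W: "W \<bullet> e1 = - f * m" "W \<bullet> e2 = - f * g" "W \<bullet> e3 = f2"
    and A: "A \<bullet> e1 = x1" "A \<bullet> e2 = - x2" "A \<bullet> e3 = l"
    and B: "B \<bullet> e1 = x2" "B \<bullet> e2 = y1" "B \<bullet> e3 = m"
    and K: "K \<bullet> e1 = - y1" "K \<bullet> e2 = y2" "K \<bullet> e3 = g"
    and A': "A' \<bullet> e1 = f * P1 - 2 * f1 * l" "A' \<bullet> e2 = f * P2 - 2 * f1 * m"
      "A' \<bullet> e3 = f11 - f * (l\<^sup>2 + m\<^sup>2)"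
    and B': "B' \<bullet> e3 = f12 - f * (l * m + m * g)"
    and K': "K' \<bullet> e1 = f * Q1 - 2 * f2 * m" "K' \<bullet> e2 = f * Q2 - 2 * f2 * g"
      "K' \<bullet> e3 = f22 - f * (m\<^sup>2 + g\<^sup>2)"
  shows "has_second_derivative (\<lambda>s. mean_curvature_of (e1 + s *\<^sub>R V) (e2 + s *\<^sub>R W)
      (A + s *\<^sub>R A') (B + s *\<^sub>R B') (K + s *\<^sub>R K'))
    (f1\<^sup>2 * (l - g) / 2 + f2\<^sup>2 * (g - l) / 2
     + f\<^sup>2 * (- 6 * (l * m + m * g) * m + 12 * l * m\<^sup>2 + 12 * g * m\<^sup>2
        - 3 * l * (l\<^sup>2 + m\<^sup>2) - 3 * g * (m\<^sup>2 + g\<^sup>2) + 4 * l ^ 3 + 4 * g ^ 3)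
     + 2 * f1 * f2 * m
     + f * f1 * (- Q1 - P1 - 3 * l * x1 + 2 * g * y1 + l * y1 - m * y2 - 3 * m * x2)
     + f * f2 * (- P2 - Q2 - 3 * g * y2 + 2 * l * x2 + g * x2 - m * x1 - 3 * m * y1)
     + 2 * f * f22 * g + 2 * f * f11 * l + 4 * f * f12 * m) 0"
proof -
  define E where "E s = (e1 + s *\<^sub>R V) \<bullet> (e1 + s *\<^sub>R V)" for s
  define F where "F s = (e1 + s *\<^sub>R V) \<bullet> (e2 + s *\<^sub>R W)" for s
  define G where "G s = (e2 + s *\<^sub>R W) \<bullet> (e2 + s *\<^sub>R W)" for s
  have E_eq: "E = (\<lambda>s. 1 + 2 * (V \<bullet> e1) * s + (V \<bullet> V) * s\<^sup>2 + 0 * s ^ 3)"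
    by (simp add: fun_eq_iff E_def inner_simps inner_commute algebra_simps power2_eq_square)
  have E: "has_jet2 E 1 (- 2 * f * l) (2 * (f\<^sup>2 * (l\<^sup>2 + m\<^sup>2) + f1\<^sup>2))"
    unfolding E_eq by (rule has_jet2_eq_rhs[OF has_jet2_cubic])
      (simp_all add: inner_expand[of V V] V algebra_simps power2_eq_square)
  have F_eq: "F = (\<lambda>s. 0 + (V \<bullet> e2 + W \<bullet> e1) * s + (V \<bullet> W) * s\<^sup>2 + 0 * s ^ 3)"
    by (simp add: fun_eq_iff F_def inner_simps inner_commute algebra_simps power2_eq_square)
  have F: "has_jet2 F 0 (- 2 * f * m) (2 * (f\<^sup>2 * (l * m + m * g) + f1 * f2))"
    unfolding F_eq by (rule has_jet2_eq_rhs[OF has_jet2_cubic])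
      (simp_all add: inner_expand[of V W] V W algebra_simps power2_eq_square)
  have G_eq: "G = (\<lambda>s. 1 + 2 * (W \<bullet> e2) * s + (W \<bullet> W) * s\<^sup>2 + 0 * s ^ 3)"
    by (simp add: fun_eq_iff G_def inner_simps inner_commute algebra_simps power2_eq_square)
  have G: "has_jet2 G 1 (- 2 * f * g) (2 * (f\<^sup>2 * (m\<^sup>2 + g\<^sup>2) + f2\<^sup>2))"
    unfolding G_eq by (rule has_jet2_eq_rhs[OF has_jet2_cubic])
      (simp_all add: inner_expand[of W W] W algebra_simps power2_eq_square)
  \<comment> \<open>The difference is written as a sum with a factor -1, the form produced by the
    jet rules for sums, products and constants.\<close>
  have D: "has_jet2 (\<lambda>s. E s * G s + (-1) * (F s * F s)) 1 (- 2 * f * (l + g))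
     (2 * (f\<^sup>2 * (l\<^sup>2 + m\<^sup>2) + f1\<^sup>2) + 8 * f\<^sup>2 * l * g
       + 2 * (f\<^sup>2 * (m\<^sup>2 + g\<^sup>2) + f2\<^sup>2) - 8 * f\<^sup>2 * m\<^sup>2)"
    by (rule has_jet2_eq_rhs[OF has_jet2_add[OF has_jet2_mult[OF E G]
            has_jet2_mult[OF has_jet2_const has_jet2_mult[OF F F]]]])
      (simp_all add: algebra_simps power2_eq_square)
  let ?L = "\<lambda>s. (A + s *\<^sub>R A') \<bullet> cross3 (e1 + s *\<^sub>R V) (e2 + s *\<^sub>R W)"
  let ?M = "\<lambda>s. (B + s *\<^sub>R B') \<bullet> cross3 (e1 + s *\<^sub>R V) (e2 + s *\<^sub>R W)"
  let ?N = "\<lambda>s. (K + s *\<^sub>R K') \<bullet> cross3 (e1 + s *\<^sub>R V) (e2 + s *\<^sub>R W)"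
  note L = has_jet2_triple[of A A' V W, unfolded A A' V W]
  note M = has_jet2_triple[of B B' V W, unfolded B B' V W]
  note N = has_jet2_triple[of K K' V W, unfolded K K' V W]
  note P = has_jet2_add[OF has_jet2_add[OF has_jet2_mult[OF E N]
        has_jet2_mult[OF has_jet2_const[of "-2"] has_jet2_mult[OF F M]]] has_jet2_mult[OF G L]]
  have *: "(\<lambda>s. mean_curvature_of (e1 + s *\<^sub>R V) (e2 + s *\<^sub>R W)
      (A + s *\<^sub>R A') (B + s *\<^sub>R B') (K + s *\<^sub>R K')) =
    (\<lambda>s. 1 / 2 * ((E s * ?N s + (-2) * (F s * ?M s) + G s * ?L s)
       * (E s * G s + (-1) * (F s * F s)) powr (- 3 / 2)))"
    by (simp add: fun_eq_iff mean_curvature_of_def E_def F_def G_def power2_eq_square)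
  show ?thesis
    \<comment> \<open>The value and the first derivative are left schematic and are settled by
      \<open>refl\<close>; only the equation for the second derivative is a genuine goal, and it is
      a polynomial identity.\<close>
    unfolding *
    by (rule has_jet2_imp_has_second_derivative,
        rule has_jet2_eq_rhs[OF has_jet2_mult[OF has_jet2_const has_jet2_mult[OF P has_jet2_powr[OF D]]]],
        rule refl, rule refl) (simp add: field_simps, algebra)
qed

end

subsection \<open>Normal variations\<close>

lemma bounded_bilinear_cross3: "bounded_bilinear cross3"
  using bilinear_cross bilinear_conv_bounded_bilinear by blast

text \<open>The variation is affine in \<open>s\<close>, so every partial derivative is too; the
  coefficient of \<open>s\<close> is the Leibniz expansion of the derivative of \<phi> N.\<close>

lemma partials_normal_variation:
  fixes X N :: "real \<times> real \<Rightarrow> 'a::real_normed_vector"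
  assumes \<Omega>: "open \<Omega>" "p \<in> \<Omega>"
    and C2: "Ck_on 2 X \<Omega>" "Ck_on 2 N \<Omega>" "Ck_on 2 \<phi> \<Omega>"
  defines "Y \<equiv> \<lambda>s q. X q + (s * \<phi> q) *\<^sub>R N q"
  shows "\<partial>\<^sub>t (Y s) p = \<partial>\<^sub>t X p + s *\<^sub>R (\<partial>\<^sub>t \<phi> p *\<^sub>R N p + \<phi> p *\<^sub>R \<partial>\<^sub>t N p)"
    and "\<partial>\<^sub>\<theta> (Y s) p = \<partial>\<^sub>\<theta> X p + s *\<^sub>R (\<partial>\<^sub>\<theta> \<phi> p *\<^sub>R N p + \<phi> p *\<^sub>R \<partial>\<^sub>\<theta> N p)"
    and "\<partial>\<^sub>t (\<partial>\<^sub>t (Y s)) p = \<partial>\<^sub>t (\<partial>\<^sub>t X) p + s *\<^sub>R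
      (\<partial>\<^sub>t (\<partial>\<^sub>t \<phi>) p *\<^sub>R N p + (2 * \<partial>\<^sub>t \<phi> p) *\<^sub>R \<partial>\<^sub>t N p + \<phi> p *\<^sub>R \<partial>\<^sub>t (\<partial>\<^sub>t N) p)"
    and "\<partial>\<^sub>\<theta> (\<partial>\<^sub>t (Y s)) p = \<partial>\<^sub>\<theta> (\<partial>\<^sub>t X) p + s *\<^sub>R
      (\<partial>\<^sub>\<theta> (\<partial>\<^sub>t \<phi>) p *\<^sub>R N p + \<partial>\<^sub>t \<phi> p *\<^sub>R \<partial>\<^sub>\<theta> N p + \<partial>\<^sub>\<theta> \<phi> p *\<^sub>R \<partial>\<^sub>t N p + \<phi> p *\<^sub>R \<partial>\<^sub>\<theta> (\<partial>\<^sub>t N) p)"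
    and "\<partial>\<^sub>\<theta> (\<partial>\<^sub>\<theta> (Y s)) p = \<partial>\<^sub>\<theta> (\<partial>\<^sub>\<theta> X) p + s *\<^sub>R
      (\<partial>\<^sub>\<theta> (\<partial>\<^sub>\<theta> \<phi>) p *\<^sub>R N p + (2 * \<partial>\<^sub>\<theta> \<phi> p) *\<^sub>R \<partial>\<^sub>\<theta> N p + \<phi> p *\<^sub>R \<partial>\<^sub>\<theta> (\<partial>\<^sub>\<theta> N) p)"
proof -
  note d = Ck_on_2_imp_differentiable_at[OF C2(1) \<Omega>(1)] Ck_on_2_imp_differentiable_at[OF C2(2) \<Omega>(1)]
    Ck_on_2_imp_differentiable_at[OF C2(3) \<Omega>(1)]
  \<comment> \<open>The first partials are needed on all of \<Omega>, since they are differentiated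
    once more at \<open>p\<close>.\<close>
  have Yt: "\<partial>\<^sub>t (Y s) q = \<partial>\<^sub>t X q + s *\<^sub>R (\<partial>\<^sub>t \<phi> q *\<^sub>R N q + \<phi> q *\<^sub>R \<partial>\<^sub>t N q)"
    and Yh: "\<partial>\<^sub>\<theta> (Y s) q = \<partial>\<^sub>\<theta> X q + s *\<^sub>R (\<partial>\<^sub>\<theta> \<phi> q *\<^sub>R N q + \<phi> q *\<^sub>R \<partial>\<^sub>\<theta> N q)" if "q \<in> \<Omega>" for q
    unfolding Y_def using d[OF that]
    by (simp_all add: partials_add partials_scaleR partials_mult algebra_simps)
  note d = d[OF \<Omega>(2)]
  have double: "(2 * r) *\<^sub>R v = r *\<^sub>R v + r *\<^sub>R v" for r and v :: 'a
    by (simp flip: scaleR_left_distrib)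
  show "\<partial>\<^sub>t (Y s) p = \<partial>\<^sub>t X p + s *\<^sub>R (\<partial>\<^sub>t \<phi> p *\<^sub>R N p + \<phi> p *\<^sub>R \<partial>\<^sub>t N p)"
    "\<partial>\<^sub>\<theta> (Y s) p = \<partial>\<^sub>\<theta> X p + s *\<^sub>R (\<partial>\<^sub>\<theta> \<phi> p *\<^sub>R N p + \<phi> p *\<^sub>R \<partial>\<^sub>\<theta> N p)"
    by (rule Yt[OF \<Omega>(2)] Yh[OF \<Omega>(2)])+
  show "\<partial>\<^sub>t (\<partial>\<^sub>t (Y s)) p = \<partial>\<^sub>t (\<partial>\<^sub>t X) p + s *\<^sub>R
      (\<partial>\<^sub>t (\<partial>\<^sub>t \<phi>) p *\<^sub>R N p + (2 * \<partial>\<^sub>t \<phi> p) *\<^sub>R \<partial>\<^sub>t N p + \<phi> p *\<^sub>R \<partial>\<^sub>t (\<partial>\<^sub>t N) p)"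
    unfolding double by (subst partials_cong(1)[OF \<Omega> Yt], assumption)
      (simp add: d partials_add partials_scaleR partials_mult algebra_simps)
  show "\<partial>\<^sub>\<theta> (\<partial>\<^sub>t (Y s)) p = \<partial>\<^sub>\<theta> (\<partial>\<^sub>t X) p + s *\<^sub>R
      (\<partial>\<^sub>\<theta> (\<partial>\<^sub>t \<phi>) p *\<^sub>R N p + \<partial>\<^sub>t \<phi> p *\<^sub>R \<partial>\<^sub>\<theta> N p + \<partial>\<^sub>\<theta> \<phi> p *\<^sub>R \<partial>\<^sub>t N p + \<phi> p *\<^sub>R \<partial>\<^sub>\<theta> (\<partial>\<^sub>t N) p)"
    by (subst partials_cong(2)[OF \<Omega> Yt], assumption)
      (simp add: d partials_add partials_scaleR partials_mult algebra_simps)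
  show "\<partial>\<^sub>\<theta> (\<partial>\<^sub>\<theta> (Y s)) p = \<partial>\<^sub>\<theta> (\<partial>\<^sub>\<theta> X) p + s *\<^sub>R
      (\<partial>\<^sub>\<theta> (\<partial>\<^sub>\<theta> \<phi>) p *\<^sub>R N p + (2 * \<partial>\<^sub>\<theta> \<phi> p) *\<^sub>R \<partial>\<^sub>\<theta> N p + \<phi> p *\<^sub>R \<partial>\<^sub>\<theta> (\<partial>\<^sub>\<theta> N) p)"
    unfolding double by (subst partials_cong(2)[OF \<Omega> Yh], assumption)
      (simp add: d partials_add partials_scaleR partials_mult algebra_simps)
qed

text \<open>This turns the relations N.N = 1, N.X_t = N.X_theta = 0 and X_t.X_theta = 0 into
  relations between derivatives, moving a derivative from one factor to the other.\<close>

lemma partials_inner_const_on: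
  fixes f g :: "real \<times> real \<Rightarrow> 'a::real_inner"
  assumes "open \<Omega>" "q \<in> \<Omega>" "\<And>x. x \<in> \<Omega> \<Longrightarrow> f x \<bullet> g x = c"
    and "f differentiable (at q)" "g differentiable (at q)"
  shows "f q \<bullet> \<partial>\<^sub>t g q = - (\<partial>\<^sub>t f q \<bullet> g q)" "f q \<bullet> \<partial>\<^sub>\<theta> g q = - (\<partial>\<^sub>\<theta> f q \<bullet> g q)"
  using partials_cong[OF assms(1,2), of "\<lambda>x. f x \<bullet> g x" "\<lambda>_. c"] assms(3-5)
  by (simp_all add: partials_inner add_eq_0_iff)

lemma partials_norm_power2:
  fixes f :: "real \<times> real \<Rightarrow> 'a::real_inner"
  assumes "f differentiable (at q)"
  shows "\<partial>\<^sub>t (\<lambda>q. (norm (f q))\<^sup>2) q = 2 * (\<partial>\<^sub>t f q \<bullet> f q)"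
    "\<partial>\<^sub>\<theta> (\<lambda>q. (norm (f q))\<^sup>2) q = 2 * (\<partial>\<^sub>\<theta> f q \<bullet> f q)"
  using assms by (simp_all add: power2_norm_eq_inner partials_inner inner_commute)

section \<open>The second variation formula\<close>

theorem propositionB2:
  fixes \<Omega> :: "(real \<times> real) set"
    and X N :: "real \<times> real \<Rightarrow> real^3"
    and \<phi> :: "real \<times> real \<Rightarrow> real"
    and p :: "real \<times> real"
  assumes domain: "open \<Omega>" "connected \<Omega>"
    and smooth: "smooth_on X \<Omega>"
    and regular: "\<forall>q\<in>\<Omega>. cross3 (\<partial>\<^sub>t X q) (\<partial>\<^sub>\<theta> X q) \<noteq> 0"
    and orthogonal: "\<forall>q\<in>\<Omega>. \<partial>\<^sub>t X q \<bullet> \<partial>\<^sub>\<theta> X q = 0"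
    and normal: "\<forall>q\<in>\<Omega>. N q = cross3 (\<partial>\<^sub>t X q) (\<partial>\<^sub>\<theta> X q) /\<^sub>R (norm (\<partial>\<^sub>t X q) * norm (\<partial>\<^sub>\<theta> X q))"
    and phi: "Ck_on 2 \<phi> \<Omega>"
    and p: "p \<in> \<Omega>"
  shows
    "let Xt = \<partial>\<^sub>t X p; X\<theta> = \<partial>\<^sub>\<theta> X p;
         Xtt = \<partial>\<^sub>t (\<partial>\<^sub>t X) p; Xt\<theta> = \<partial>\<^sub>\<theta> (\<partial>\<^sub>t X) p; X\<theta>\<theta> = \<partial>\<^sub>\<theta> (\<partial>\<^sub>\<theta> X) p;
         n = N p; Nt = \<partial>\<^sub>t N p; N\<theta> = \<partial>\<^sub>\<theta> N p;
         Ntt = \<partial>\<^sub>t (\<partial>\<^sub>t N) p; N\<theta>\<theta> = \<partial>\<^sub>\<theta> (\<partial>\<^sub>\<theta> N) p;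
         f = \<phi> p; ft = \<partial>\<^sub>t \<phi> p; f\<theta> = \<partial>\<^sub>\<theta> \<phi> p;
         ftt = \<partial>\<^sub>t (\<partial>\<^sub>t \<phi>) p; ft\<theta> = \<partial>\<^sub>\<theta> (\<partial>\<^sub>t \<phi>) p; f\<theta>\<theta> = \<partial>\<^sub>\<theta> (\<partial>\<^sub>\<theta> \<phi>) p;
         dt_Xt2 = \<partial>\<^sub>t (\<lambda>q. (norm (\<partial>\<^sub>t X q))\<^sup>2) p;
         d\<theta>_Xt2 = \<partial>\<^sub>\<theta> (\<lambda>q. (norm (\<partial>\<^sub>t X q))\<^sup>2) p;
         dt_X\<theta>2 = \<partial>\<^sub>t (\<lambda>q. (norm (\<partial>\<^sub>\<theta> X q))\<^sup>2) p;
         d\<theta>_X\<theta>2 = \<partial>\<^sub>\<theta> (\<lambda>q. (norm (\<partial>\<^sub>\<theta> X q))\<^sup>2) p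
     in has_second_derivative (\<lambda>s. mean_curvature (\<lambda>q. X q + (s * \<phi> q) *\<^sub>R N q) p)
      (ft\<^sup>2 * (1/2 * (Xtt \<bullet> n) / norm Xt ^ 4
              - 1/2 * (X\<theta>\<theta> \<bullet> n) / (norm Xt ^ 2 * norm X\<theta> ^ 2))
     + f\<theta>\<^sup>2 * (- 1/2 * (Xtt \<bullet> n) / (norm Xt ^ 2 * norm X\<theta> ^ 2)
              + 1/2 * (X\<theta>\<theta> \<bullet> n) / norm X\<theta> ^ 4)
     + f\<^sup>2 * (- 6 * ((Nt \<bullet> N\<theta>) * (Xt\<theta> \<bullet> n)) / (norm Xt ^ 2 * norm X\<theta> ^ 2)
             + 12 * ((Xtt \<bullet> n) * (Xt\<theta> \<bullet> n)\<^sup>2) / (norm Xt ^ 4 * norm X\<theta> ^ 2)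
             + 12 * ((X\<theta>\<theta> \<bullet> n) * (Xt\<theta> \<bullet> n)\<^sup>2) / (norm Xt ^ 2 * norm X\<theta> ^ 4)
             - 3 * ((Xtt \<bullet> n) * norm Nt ^ 2) / norm Xt ^ 4
             - 3 * ((X\<theta>\<theta> \<bullet> n) * norm N\<theta> ^ 2) / norm X\<theta> ^ 4
             + 4 * (Xtt \<bullet> n) ^ 3 / norm Xt ^ 6
             + 4 * (X\<theta>\<theta> \<bullet> n) ^ 3 / norm X\<theta> ^ 6)
     + ft * f\<theta> * (2 * (Xt\<theta> \<bullet> n) / (norm Xt ^ 2 * norm X\<theta> ^ 2))
     + f * ft * (- (N\<theta>\<theta> \<bullet> Xt) / (norm Xt ^ 2 * norm X\<theta> ^ 2)
                 - (Ntt \<bullet> Xt) / norm Xt ^ 4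
                 - 3/2 * (Xtt \<bullet> n) / norm Xt ^ 6 * dt_Xt2
                 + (X\<theta>\<theta> \<bullet> n) / (norm Xt ^ 2 * norm X\<theta> ^ 4) * dt_X\<theta>2
                 + 1/2 * (Xtt \<bullet> n) / (norm Xt ^ 4 * norm X\<theta> ^ 2) * dt_X\<theta>2
                 - 1/2 * (Xt\<theta> \<bullet> n) / (norm Xt ^ 2 * norm X\<theta> ^ 4) * d\<theta>_X\<theta>2
                 - 3/2 * (Xt\<theta> \<bullet> n) / (norm Xt ^ 4 * norm X\<theta> ^ 2) * d\<theta>_Xt2)
     + f * f\<theta> * (- (Ntt \<bullet> X\<theta>) / (norm Xt ^ 2 * norm X\<theta> ^ 2)
                 - (N\<theta>\<theta> \<bullet> X\<theta>) / norm X\<theta> ^ 4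
                 - 3/2 * (X\<theta>\<theta> \<bullet> n) / norm X\<theta> ^ 6 * d\<theta>_X\<theta>2
                 + (Xtt \<bullet> n) / (norm Xt ^ 4 * norm X\<theta> ^ 2) * d\<theta>_Xt2
                 + 1/2 * (X\<theta>\<theta> \<bullet> n) / (norm Xt ^ 2 * norm X\<theta> ^ 4) * d\<theta>_Xt2
                 - 1/2 * (Xt\<theta> \<bullet> n) / (norm Xt ^ 4 * norm X\<theta> ^ 2) * dt_Xt2
                 - 3/2 * (Xt\<theta> \<bullet> n) / (norm Xt ^ 2 * norm X\<theta> ^ 4) * dt_X\<theta>2)
     + f * f\<theta>\<theta> * (2 * (X\<theta>\<theta> \<bullet> n) / norm X\<theta> ^ 4)
     + f * ftt * (2 * (Xtt \<bullet> n) / norm Xt ^ 4)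
     + f * ft\<theta> * (4 * (Xt\<theta> \<bullet> n) / (norm Xt ^ 2 * norm X\<theta> ^ 2))) 0"
proof -
  \<comment> \<open>Three derivatives of \<open>X\<close> make its first partials, and through them
    \<open>N\<close>, of class C^2.\<close>
  have X3: "Ck_on (Suc 2) X \<Omega>"
    using smooth by (simp only: smooth_on_def)
  then have X2: "Ck_on 2 X \<Omega>" "Ck_on 2 (\<partial>\<^sub>t X) \<Omega>" "Ck_on 2 (\<partial>\<^sub>\<theta> X) \<Omega>"
    using Ck_on_Suc_imp_Ck_on[OF X3] unfolding Ck_on.simps(2) by blast+
  have nz: "\<partial>\<^sub>t X q \<noteq> 0" "\<partial>\<^sub>\<theta> X q \<noteq> 0" if "q \<in> \<Omega>" for q
    using regular that by force+
  \<comment> \<open>The factor 1/(|X_t| |X_theta|) is rewritten as the power -1/2 of a positive C^2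
    function, which avoids differentiating norms.\<close>
  have "Ck_on 2 (\<lambda>q. ((\<partial>\<^sub>t X q \<bullet> \<partial>\<^sub>t X q) * (\<partial>\<^sub>\<theta> X q \<bullet> \<partial>\<^sub>\<theta> X q)) powr (- (1 / 2)) *\<^sub>R
      cross3 (\<partial>\<^sub>t X q) (\<partial>\<^sub>\<theta> X q)) \<Omega>"
    using X2 domain(1) nz
    by (intro bounded_bilinear.Ck_on[OF bounded_bilinear_scaleR] Ck_on_powr
        bounded_bilinear.Ck_on[OF bounded_bilinear_cross3]
        bounded_bilinear.Ck_on[OF bounded_bilinear_inner]
        bounded_bilinear.Ck_on[OF bounded_bilinear_mult]) simp_all
  moreover have "((\<partial>\<^sub>t X q \<bullet> \<partial>\<^sub>t X q) * (\<partial>\<^sub>\<theta> X q \<bullet> \<partial>\<^sub>\<theta> X q)) powr (- (1 / 2)) *\<^sub>R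
      cross3 (\<partial>\<^sub>t X q) (\<partial>\<^sub>\<theta> X q) = N q" if "q \<in> \<Omega>" for q
    using normal that by (simp add: powr_minus powr_half_sqrt real_sqrt_mult norm_eq_sqrt_inner)
  ultimately have N2: "Ck_on 2 N \<Omega>"
    by (rule Ck_on_cong[OF domain(1), rotated])

  note dX = Ck_on_2_imp_differentiable_at[OF X2(1) domain(1)]
  note dN = Ck_on_2_imp_differentiable_at[OF N2 domain(1)]
  \<comment> \<open>Orthogonality gives |X_t x X_theta| = |X_t| |X_theta|, so the prescribed factor
    does normalise \<open>N\<close>.\<close>
  have NN: "N q \<bullet> N q = 1" and NX: "N q \<bullet> \<partial>\<^sub>t X q = 0" "N q \<bullet> \<partial>\<^sub>\<theta> X q = 0" if "q \<in> \<Omega>" for q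
  proof -
    have "norm (cross3 (\<partial>\<^sub>t X q) (\<partial>\<^sub>\<theta> X q)) = norm (\<partial>\<^sub>t X q) * norm (\<partial>\<^sub>\<theta> X q)"
      unfolding norm_cross3_eq using orthogonal that by (simp add: real_sqrt_mult norm_eq_sqrt_inner)
    then have "norm (N q) = 1"
      using normal that nz[OF that] by (simp add: field_simps)
    then show "N q \<bullet> N q = 1" by (simp add: dot_square_norm)
    show "N q \<bullet> \<partial>\<^sub>t X q = 0" "N q \<bullet> \<partial>\<^sub>\<theta> X q = 0"
      using normal that by (simp_all add: dot_cross_self inner_commute)
  qed
  have NNt: "N q \<bullet> \<partial>\<^sub>t N q = 0" and NNh: "N q \<bullet> \<partial>\<^sub>\<theta> N q = 0" if "q \<in> \<Omega>" for q
    using partials_inner_const_on[OF domain(1) that NN dN(1)[OF that] dN(1)[OF that]]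
    by (simp_all add: inner_commute)

  define Xt Xh Xtt Xth Xhh where X_defs: "Xt = \<partial>\<^sub>t X p" "Xh = \<partial>\<^sub>\<theta> X p"
    "Xtt = \<partial>\<^sub>t (\<partial>\<^sub>t X) p" "Xth = \<partial>\<^sub>\<theta> (\<partial>\<^sub>t X) p" "Xhh = \<partial>\<^sub>\<theta> (\<partial>\<^sub>\<theta> X) p"
  define n Nt Nh Ntt Nth Nhh where N_defs: "n = N p" "Nt = \<partial>\<^sub>t N p" "Nh = \<partial>\<^sub>\<theta> N p"
    "Ntt = \<partial>\<^sub>t (\<partial>\<^sub>t N) p" "Nth = \<partial>\<^sub>\<theta> (\<partial>\<^sub>t N) p" "Nhh = \<partial>\<^sub>\<theta> (\<partial>\<^sub>\<theta> N) p"
  define f ft fh ftt fth fhh where f_defs: "f = \<phi> p" "ft = \<partial>\<^sub>t \<phi> p" "fh = \<partial>\<^sub>\<theta> \<phi> p"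
    "ftt = \<partial>\<^sub>t (\<partial>\<^sub>t \<phi>) p" "fth = \<partial>\<^sub>\<theta> (\<partial>\<^sub>t \<phi>) p" "fhh = \<partial>\<^sub>\<theta> (\<partial>\<^sub>\<theta> \<phi>) p"
  note fold_defs = X_defs[symmetric] N_defs[symmetric] f_defs[symmetric]

  have Xht: "\<partial>\<^sub>t (\<partial>\<^sub>\<theta> X) p = Xth"
    using mixed_partials_commute[OF domain(1) X2(1) p] by (simp add: X_defs)
  have nn: "n \<bullet> n = 1" "n \<bullet> Nt = 0" "n \<bullet> Nh = 0" "n \<bullet> Xt = 0" "n \<bullet> Xh = 0" "Xt \<bullet> Xh = 0"
    using NN NNt NNh NX orthogonal p by (simp_all add: X_defs N_defs)
  then have nN: "Nt \<bullet> n = 0" "Nh \<bullet> n = 0"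
    by (simp_all add: inner_commute)
  note d = dX[OF p] dN[OF p]
  \<comment> \<open>In order: the Weingarten relations from N.X_t = 0 and N.X_theta = 0, the normal
    parts of the second derivatives of \<open>N\<close> from N.N_t = N.N_theta = 0, and the mixed
    tangential parts of those of \<open>X\<close> from X_t.X_theta = 0.\<close>
  have second: "Nt \<bullet> Xt = - (Xtt \<bullet> n)" "Nh \<bullet> Xt = - (Xth \<bullet> n)"
      "Nt \<bullet> Xh = - (Xth \<bullet> n)" "Nh \<bullet> Xh = - (Xhh \<bullet> n)"
      "Ntt \<bullet> n = - (Nt \<bullet> Nt)" "Nth \<bullet> n = - (Nt \<bullet> Nh)" "Nhh \<bullet> n = - (Nh \<bullet> Nh)"
      "Xtt \<bullet> Xh = - (Xth \<bullet> Xt)" "Xhh \<bullet> Xt = - (Xth \<bullet> Xh)"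
    using partials_inner_const_on[OF domain(1) p NX(1) d(4) d(2)]
      partials_inner_const_on[OF domain(1) p NX(2) d(4) d(3)]
      partials_inner_const_on[OF domain(1) p NNt d(4) d(5)]
      partials_inner_const_on[OF domain(1) p NNh d(4) d(6)]
      partials_inner_const_on[OF domain(1) p orthogonal[rule_format] d(2) d(3)]
    unfolding Xht fold_defs by (simp_all add: inner_commute)

  define a b where "a = norm Xt" and "b = norm Xh"
  have ab: "a > 0" "b > 0" "Xt \<bullet> Xt = a\<^sup>2" "Xh \<bullet> Xh = b\<^sup>2"
    using nz[OF p] by (simp_all add: a_def b_def X_defs power2_norm_eq_inner)
  define e1 e2 where e_defs: "e1 = Xt /\<^sub>R a" "e2 = Xh /\<^sub>R b"
  interpret orthonormal_pair e1 e2
    using ab nn by unfold_locales (simp_all add: e_defs power2_eq_square field_simps)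
  have e3: "cross3 e1 e2 = n"
    using normal[rule_format, OF p] unfolding fold_defs
    by (simp add: e_defs a_def b_def cross_mult_left cross_mult_right mult.commute)

  \<comment> \<open>The coefficients of \<open>s\<close> in the partials of the variation, rescaled
    like the corresponding partials of \<open>X\<close>: one factor 1/a for each t-derivative and
    1/b for each \<theta>-derivative.\<close>
  define V W A' B' K' where V_defs: "V = (ft *\<^sub>R n + f *\<^sub>R Nt) /\<^sub>R a" "W = (fh *\<^sub>R n + f *\<^sub>R Nh) /\<^sub>R b"
    "A' = (ftt *\<^sub>R n + (2 * ft) *\<^sub>R Nt + f *\<^sub>R Ntt) /\<^sub>R a\<^sup>2"
    "B' = (fth *\<^sub>R n + ft *\<^sub>R Nh + fh *\<^sub>R Nt + f *\<^sub>R Nth) /\<^sub>R (a * b)"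
    "K' = (fhh *\<^sub>R n + (2 * fh) *\<^sub>R Nh + f *\<^sub>R Nhh) /\<^sub>R b\<^sup>2"
  have "mean_curvature (\<lambda>q. X q + (s * \<phi> q) *\<^sub>R N q) p = mean_curvature_of (e1 + s *\<^sub>R V) (e2 + s *\<^sub>R W)
      (Xtt /\<^sub>R a\<^sup>2 + s *\<^sub>R A') (Xth /\<^sub>R (a * b) + s *\<^sub>R B') (Xhh /\<^sub>R b\<^sup>2 + s *\<^sub>R K')" for s
    unfolding mean_curvature_eq partials_normal_variation[OF domain(1) p X2(1) N2 phi] fold_defs
    using ab(1,2)
    by (subst mean_curvature_of_scale[of "inverse a" "inverse b", symmetric])
      (simp_all add: V_defs e_defs scaleR_add_right power_inverse mult_ac)
  then have H: "(\<lambda>s. mean_curvature (\<lambda>q. X q + (s * \<phi> q) *\<^sub>R N q) p) =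
    (\<lambda>s. mean_curvature_of (e1 + s *\<^sub>R V) (e2 + s *\<^sub>R W)
      (Xtt /\<^sub>R a\<^sup>2 + s *\<^sub>R A') (Xth /\<^sub>R (a * b) + s *\<^sub>R B') (Xhh /\<^sub>R b\<^sup>2 + s *\<^sub>R K'))"
    by blast

  \<comment> \<open>In the orthonormal frame, \<open>l\<close>, \<open>m\<close>, \<open>g\<close>
    are the coefficients of the second fundamental form, \<open>x1\<close>, \<open>x2\<close>,
    \<open>y1\<close>, \<open>y2\<close> are up to scale the derivatives of |X_t|^2 and |X_theta|^2,
    and \<open>P1\<close>, \<open>P2\<close>, \<open>Q1\<close>, \<open>Q2\<close> are the
    tangential parts of N_tt and N_theta_theta.\<close>
  define l m g x1 x2 y1 y2 P1 P2 Q1 Q2 where l_defs: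
    "l = (Xtt \<bullet> n) / a\<^sup>2" "m = (Xth \<bullet> n) / (a * b)" "g = (Xhh \<bullet> n) / b\<^sup>2"
    "x1 = (Xtt \<bullet> Xt) / a ^ 3" "x2 = (Xth \<bullet> Xt) / (a\<^sup>2 * b)"
    "y1 = (Xth \<bullet> Xh) / (a * b\<^sup>2)" "y2 = (Xhh \<bullet> Xh) / b ^ 3"
    "P1 = (Ntt \<bullet> Xt) / a ^ 3" "P2 = (Ntt \<bullet> Xh) / (a\<^sup>2 * b)"
    "Q1 = (Nhh \<bullet> Xt) / (a * b\<^sup>2)" "Q2 = (Nhh \<bullet> Xh) / b ^ 3"
  define f1 f2 f11 f12 f22 where f1_defs: "f1 = ft / a" "f2 = fh / b"
    "f11 = ftt / a\<^sup>2" "f12 = fth / (a * b)" "f22 = fhh / b\<^sup>2"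
  \<comment> \<open>Solving for the original quantities makes every power of \<open>a\<close> and
    \<open>b\<close> explicit, so that these powers can be cancelled at the end.\<close>
  have subst: "Xtt \<bullet> n = a\<^sup>2 * l" "Xth \<bullet> n = a * b * m" "Xhh \<bullet> n = b\<^sup>2 * g"
    "Xtt \<bullet> Xt = a ^ 3 * x1" "Xth \<bullet> Xt = a\<^sup>2 * b * x2"
    "Xth \<bullet> Xh = a * b\<^sup>2 * y1" "Xhh \<bullet> Xh = b ^ 3 * y2"
    "Ntt \<bullet> Xt = a ^ 3 * P1" "Ntt \<bullet> Xh = a\<^sup>2 * b * P2"
    "Nhh \<bullet> Xt = a * b\<^sup>2 * Q1" "Nhh \<bullet> Xh = b ^ 3 * Q2"
    "ft = a * f1" "fh = b * f2" "ftt = a\<^sup>2 * f11" "fth = a * b * f12" "fhh = b\<^sup>2 * f22"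
    using ab(1,2) by (simp_all add: l_defs f1_defs)
  have frame: "Nt \<bullet> e1 = - a * l" "Nt \<bullet> e2 = - a * m" "Nh \<bullet> e1 = - b * m" "Nh \<bullet> e2 = - b * g"
    using ab(1,2) by (simp_all add: e_defs second subst power2_eq_square field_simps)
  \<comment> \<open>The third fundamental form is the square of the second: N_t and N_theta are
    tangential, so Parseval's formula involves only their Weingarten coordinates.\<close>
  have gauss: "Nt \<bullet> Nt = a\<^sup>2 * (l\<^sup>2 + m\<^sup>2)" "Nt \<bullet> Nh = a * b * (l * m + m * g)"
      "Nh \<bullet> Nh = b\<^sup>2 * (m\<^sup>2 + g\<^sup>2)"
    by (simp_all add: inner_expand[of Nt Nt] inner_expand[of Nt Nh] inner_expand[of Nh Nh]
        e3 frame nN algebra_simps power2_eq_square)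

  have second_derivative: "has_second_derivative (\<lambda>s. mean_curvature (\<lambda>q. X q + (s * \<phi> q) *\<^sub>R N q) p)
    (f1\<^sup>2 * (l - g) / 2 + f2\<^sup>2 * (g - l) / 2
     + f\<^sup>2 * (- 6 * (l * m + m * g) * m + 12 * l * m\<^sup>2 + 12 * g * m\<^sup>2
        - 3 * l * (l\<^sup>2 + m\<^sup>2) - 3 * g * (m\<^sup>2 + g\<^sup>2) + 4 * l ^ 3 + 4 * g ^ 3)
     + 2 * f1 * f2 * m
     + f * f1 * (- Q1 - P1 - 3 * l * x1 + 2 * g * y1 + l * y1 - m * y2 - 3 * m * x2)
     + f * f2 * (- P2 - Q2 - 3 * g * y2 + 2 * l * x2 + g * x2 - m * x1 - 3 * m * y1)
     + 2 * f * f22 * g + 2 * f * f11 * l + 4 * f * f12 * m) 0"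
    unfolding H
  proof (rule has_second_derivative_mean_curvature_of)
    have E: "v \<bullet> e1 = (v \<bullet> Xt) / a" "v \<bullet> e2 = (v \<bullet> Xh) / b" for v
      by (simp_all add: e_defs field_simps)
    show "V \<bullet> e1 = - f * l" "V \<bullet> e2 = - f * m" "V \<bullet> cross3 e1 e2 = f1"
      "W \<bullet> e1 = - f * m" "W \<bullet> e2 = - f * g" "W \<bullet> cross3 e1 e2 = f2"
      "(Xtt /\<^sub>R a\<^sup>2) \<bullet> e1 = x1" "(Xtt /\<^sub>R a\<^sup>2) \<bullet> e2 = - x2" "(Xtt /\<^sub>R a\<^sup>2) \<bullet> cross3 e1 e2 = l"
      "(Xth /\<^sub>R (a * b)) \<bullet> e1 = x2" "(Xth /\<^sub>R (a * b)) \<bullet> e2 = y1" "(Xth /\<^sub>R (a * b)) \<bullet> cross3 e1 e2 = m"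
      "(Xhh /\<^sub>R b\<^sup>2) \<bullet> e1 = - y1" "(Xhh /\<^sub>R b\<^sup>2) \<bullet> e2 = y2" "(Xhh /\<^sub>R b\<^sup>2) \<bullet> cross3 e1 e2 = g"
      "A' \<bullet> e1 = f * P1 - 2 * f1 * l" "A' \<bullet> e2 = f * P2 - 2 * f1 * m"
      "A' \<bullet> cross3 e1 e2 = f11 - f * (l\<^sup>2 + m\<^sup>2)"
      "B' \<bullet> cross3 e1 e2 = f12 - f * (l * m + m * g)"
      "K' \<bullet> e1 = f * Q1 - 2 * f2 * m" "K' \<bullet> e2 = f * Q2 - 2 * f2 * g"
      "K' \<bullet> cross3 e1 e2 = f22 - f * (m\<^sup>2 + g\<^sup>2)"
      unfolding e3 E V_defs using ab(1,2)
      by (simp_all add: inner_add_left nn nN second subst gauss)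
        (simp_all add: field_simps power2_eq_square power3_eq_cube)
  qed

  show ?thesis
    unfolding Let_def partials_norm_power2[OF d(2)] partials_norm_power2[OF d(3)]
    unfolding fold_defs Xht a_def[symmetric] b_def[symmetric] power2_norm_eq_inner gauss subst
    \<comment> \<open>The claimed second derivative and the one found in the frame now use the same
      symbols; clearing the powers of \<open>a\<close> and \<open>b\<close> identifies them.\<close>
    by (rule back_subst[of "\<lambda>D. has_second_derivative _ D 0", OF second_derivative])
      (use ab(1,2) in \<open>simp add: field_simps eval_nat_numeral\<close>)
qed

end
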